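(* Let $r\in\mathbb{Z}_{\ge0}$, $s\in\mathbb{Z}_{\ge1}$, and for $m,a\in\mathbb{Z}_{\ge1}$ let $$\mathcal{T}_m^a(u)=\sum_{b\in B((m^a))}\ \prod_{i=1}^{a}\prod_{j=1}^{m}(-1)^{p(b(i,j))}\,[b(i,j)]_{u-m+a-2i+2j}$$ be the function associated with $B(r|s)$ and the rectangular Young diagram with $a$ rows and $m$ columns, with $\mathcal{T}_m^0(u)=\mathcal{T}_0^a(u)=1$. Then for all $m,a\in\mathbb{Z}_{\ge1}$ $$\mathcal{T}_m^a(u-1)\,\mathcal{T}_m^a(u+1)=\mathcal{T}_{m-1}^a(u)\,\mathcal{T}_{m+1}^a(u)+\mathcal{T}_m^{a-1}(u)\,\mathcal{T}_m^{a+1}(u).$$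
   Context: $\Phi$ is an entire function, not identically zero, with a zero at $u=0$ (e.g. $\Phi(u)=u$); $N,N_a\in\mathbb{Z}_{\ge0}$; $w_j,u_j^{(a)}\in\mathbb{C}$ are parameters; $Q_a(u)=\prod_{j=1}^{N_a}\Phi(u-u_j^{(a)})$ for $1\le a\le s+r$; $Q_0(u)=1$; $\phi(u)=\prod_{j=1}^N\Phi(u-w_j)$. Identities are between meromorphic functions of $u$. **Index set.** $J=J_+\cup J_-$ with $J_-=\{1,\dots,s,\overline s,\dots,\overline1\}$, $J_+=\{s+1,\dots,s+r,\overline{s+r},\dots,\overline{s+1}\}\cup\{0\}$, totally ordered by $1\prec2\prec\cdots\prec s+r\prec0\prec\overline{s+r}\prec\cdots\prec\overline1$; $p(c)=0$ for $c\in J_+$, $p(c)=1$ for $c\in J_-$. **Tableaux.** $B((m^a))$ is the set of fillings $b(i,j)\in J$ ($1\le i\le a$ the row index, $1\le j\le m$ the column index) such that $b(i,j)\preceq b(i,j+1)$, strictly if $b(i,j)\in J_-\cup\{0\}$; and $b(i,j)\preceq b(i+1,j)$, strictly if $b(i,j)\in J_+\setminus\{0\}$. **Box functions.** - $1\le a\le s$: $[a]_u=\psi_a(u)\frac{Q_{a-1}(u-a-1)Q_a(u-a+2)}{Q_{a-1}(u-a+1)Q_a(u-a)}$. - $s+1\le a\le s+r$: $[a]_u=\psi_a(u)\frac{Q_{a-1}(u-2s+a+1)Q_a(u-2s+a-2)}{Q_{a-1}(u-2s+a-1)Q_a(u-2s+a)}$. - $[0]_u=\psi_0(u)\frac{Q_{s+r}(u-s+r+1)Q_{s+r}(u-s+r-2)}{Q_{s+r}(u-s+r-1)Q_{s+r}(u-s+r)}$.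 - $s+1\le a\le s+r$: $[\overline a]_u=\psi_{\overline a}(u)\frac{Q_{a-1}(u+2r-a-2)Q_a(u+2r-a+1)}{Q_{a-1}(u+2r-a)Q_a(u+2r-a-1)}$. - $1\le a\le s$: $[\overline a]_u=\psi_{\overline a}(u)\frac{Q_{a-1}(u-2s+2r+a)Q_a(u-2s+2r+a-3)}{Q_{a-1}(u-2s+2r+a-2)Q_a(u-2s+2r+a-1)}$. Here $\psi_1(u)=\phi(u-2)\phi(u-2s+2r-1)$, $\psi_{\overline1}(u)=\phi(u)\phi(u-2s+2r+1)$, and $\psi_c(u)=\phi(u)\phi(u-2s+2r-1)$ for all other $c\in J$. *)

theory Defs
  imports "HOL-Complex_Analysis.Complex_Analysis" "HOL-Library.FuncSet"
begin

text \<open>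
  Equality in the field of meromorphic functions on the complex plane. The pointwise values
  at poles are irrelevant (HOL totalises division by \<open>x / 0 = 0\<close>), so two representatives are
  identified when they agree outside a closed discrete set.
\<close>

definition meromorphic_eq :: "(complex \<Rightarrow> complex) \<Rightarrow> (complex \<Rightarrow> complex) \<Rightarrow> bool" where
  "meromorphic_eq f g \<longleftrightarrow>
     f meromorphic_on UNIV \<and> g meromorphic_on UNIV \<and> (\<forall>\<^sub>F u in cosparse UNIV. f u = g u)"

text \<open>
  \<open>Pl a\<close> is the letter \<open>a\<close>, \<open>Br a\<close> the letter \<open>a\<close> with a bar, \<open>Ze\<close> the letter 0.
\<close>

datatype letter = Pl nat | Ze | Br nat

fun letter_le :: "letter \<Rightarrow> letter \<Rightarrow> bool" where
  "letter_le (Pl a) (Pl b) \<longleftrightarrow> a \<le> b"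
| "letter_le (Pl a) Ze \<longleftrightarrow> True"
| "letter_le (Pl a) (Br b) \<longleftrightarrow> True"
| "letter_le Ze (Pl b) \<longleftrightarrow> False"
| "letter_le Ze Ze \<longleftrightarrow> True"
| "letter_le Ze (Br b) \<longleftrightarrow> True"
| "letter_le (Br a) (Pl b) \<longleftrightarrow> False"
| "letter_le (Br a) Ze \<longleftrightarrow> False"
| "letter_le (Br a) (Br b) \<longleftrightarrow> b \<le> a"

instantiation letter :: linorder
begin

definition less_eq_letter :: "letter \<Rightarrow> letter \<Rightarrow> bool" where
  "x \<le> y \<longleftrightarrow> letter_le x y"

definition less_letter :: "letter \<Rightarrow> letter \<Rightarrow> bool" where
  "x < y \<longleftrightarrow> letter_le x y \<and> \<not> letter_le y x"

instance
proof
  fix x y z :: letter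
  show "x < y \<longleftrightarrow> x \<le> y \<and> \<not> y \<le> x"
    by (simp add: less_eq_letter_def less_letter_def)
  show "x \<le> x"
    by (cases x) (auto simp: less_eq_letter_def)
  show "x \<le> y \<Longrightarrow> y \<le> z \<Longrightarrow> x \<le> z"
    by (cases x; cases y; cases z) (auto simp: less_eq_letter_def)
  show "x \<le> y \<Longrightarrow> y \<le> x \<Longrightarrow> x = y"
    by (cases x; cases y) (auto simp: less_eq_letter_def)
  show "x \<le> y \<or> y \<le> x"
    by (cases x; cases y) (auto simp: less_eq_letter_def)
qed

end

definition J_minus :: "nat \<Rightarrow> letter set" where
  "J_minus s = Pl ` {1..s} \<union> Br ` {1..s}"

definition J_plus :: "nat \<Rightarrow> nat \<Rightarrow> letter set" where
  "J_plus r s = Pl ` {s+1..s+r} \<union> Br ` {s+1..s+r} \<union> {Ze}"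

definition J :: "nat \<Rightarrow> nat \<Rightarrow> letter set" where
  "J r s = J_plus r s \<union> J_minus s"

definition parity :: "nat \<Rightarrow> letter \<Rightarrow> nat" where
  "parity s c = (if c \<in> J_minus s then 1 else 0)"

text \<open>
  Fillings of the rectangle with \<open>a\<close> rows and \<open>m\<close> columns; \<open>b (i, j)\<close> is the entry in row \<open>i\<close>,
  column \<open>j\<close>. The extensional function space makes each filling occur exactly once.
\<close>

definition tableaux :: "nat \<Rightarrow> nat \<Rightarrow> nat \<Rightarrow> nat \<Rightarrow> (nat \<times> nat \<Rightarrow> letter) set" where
  "tableaux r s m a = {b \<in> {1..a} \<times> {1..m} \<rightarrow>\<^sub>E J r s.
     (\<forall>i\<in>{1..a}. \<forall>j. 1 \<le> j \<and> j + 1 \<le> m \<longrightarrow>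
        b (i, j) \<le> b (i, j+1) \<and>
        (b (i, j) \<in> J_minus s \<union> {Ze} \<longrightarrow> b (i, j) < b (i, j+1))) \<and>
     (\<forall>j\<in>{1..m}. \<forall>i. 1 \<le> i \<and> i + 1 \<le> a \<longrightarrow>
        b (i, j) \<le> b (i+1, j) \<and>
        (b (i, j) \<in> J_plus r s - {Ze} \<longrightarrow> b (i, j) < b (i+1, j)))}"

text \<open>
  Throughout, \<open>n a\<close> is the number $N_a$ of parameters \<open>v a 1, \<dots>, v a (n a)\<close> (written
  $u_j^{(a)}$), and \<open>N\<close> the number of parameters \<open>w 1, \<dots>, w N\<close>.
\<close>

definition Qfun :: "(complex \<Rightarrow> complex) \<Rightarrow> (nat \<Rightarrow> nat) \<Rightarrow> (nat \<Rightarrow> nat \<Rightarrow> complex) \<Rightarrow>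
    nat \<Rightarrow> complex \<Rightarrow> complex" where
  "Qfun \<Phi> n v a u = (if a = 0 then 1 else (\<Prod>j=1..n a. \<Phi> (u - v a j)))"

definition phi :: "(complex \<Rightarrow> complex) \<Rightarrow> nat \<Rightarrow> (nat \<Rightarrow> complex) \<Rightarrow> complex \<Rightarrow> complex" where
  "phi \<Phi> N w u = (\<Prod>j=1..N. \<Phi> (u - w j))"

definition psi :: "(complex \<Rightarrow> complex) \<Rightarrow> nat \<Rightarrow> (nat \<Rightarrow> complex) \<Rightarrow> nat \<Rightarrow> nat \<Rightarrow>
    letter \<Rightarrow> complex \<Rightarrow> complex" where
  "psi \<Phi> N w r s c u =
     (let f = phi \<Phi> N w; R = of_nat r; S = of_nat s in
      if c = Pl 1 then f (u - 2) * f (u - 2*S + 2*R - 1)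
      else if c = Br 1 then f u * f (u - 2*S + 2*R + 1)
      else f u * f (u - 2*S + 2*R - 1))"

definition boxfun :: "(complex \<Rightarrow> complex) \<Rightarrow> nat \<Rightarrow> (nat \<Rightarrow> complex) \<Rightarrow>
    (nat \<Rightarrow> nat) \<Rightarrow> (nat \<Rightarrow> nat \<Rightarrow> complex) \<Rightarrow> nat \<Rightarrow> nat \<Rightarrow> letter \<Rightarrow> complex \<Rightarrow> complex" where
  "boxfun \<Phi> N w n v r s c u =
     (let Q = Qfun \<Phi> n v; R = of_nat r; S = of_nat s in
      psi \<Phi> N w r s c u *
      (case c of
         Pl a \<Rightarrow> let A = of_nat a in
           (if a \<le> s
            then (Q (a-1) (u - A - 1) * Q a (u - A + 2)) /
                 (Q (a-1) (u - A + 1) * Q a (u - A))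
            else (Q (a-1) (u - 2*S + A + 1) * Q a (u - 2*S + A - 2)) /
                 (Q (a-1) (u - 2*S + A - 1) * Q a (u - 2*S + A)))
       | Ze \<Rightarrow>
           (Q (s+r) (u - S + R + 1) * Q (s+r) (u - S + R - 2)) /
           (Q (s+r) (u - S + R - 1) * Q (s+r) (u - S + R))
       | Br a \<Rightarrow> let A = of_nat a in
           (if a \<le> s
            then (Q (a-1) (u - 2*S + 2*R + A) * Q a (u - 2*S + 2*R + A - 3)) /
                 (Q (a-1) (u - 2*S + 2*R + A - 2) * Q a (u - 2*S + 2*R + A - 1))
            else (Q (a-1) (u + 2*R - A - 2) * Q a (u + 2*R - A + 1)) /
                 (Q (a-1) (u + 2*R - A) * Q a (u + 2*R - A - 1)))))"

definition T :: "(complex \<Rightarrow> complex) \<Rightarrow> nat \<Rightarrow> (nat \<Rightarrow> complex) \<Rightarrow>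
    (nat \<Rightarrow> nat) \<Rightarrow> (nat \<Rightarrow> nat \<Rightarrow> complex) \<Rightarrow> nat \<Rightarrow> nat \<Rightarrow> nat \<Rightarrow> nat \<Rightarrow> complex \<Rightarrow> complex" where
  "T \<Phi> N w n v r s m a u =
     (if m = 0 \<or> a = 0 then 1
      else (\<Sum>b\<in>tableaux r s m a. \<Prod>i=1..a. \<Prod>j=1..m.
              (-1) ^ parity s (b (i, j)) *
              boxfun \<Phi> N w n v r s (b (i, j))
                (u - of_nat m + of_nat a - 2 * of_nat i + 2 * of_nat j)))"

end

theory Submission
  imports Defs "Jordan_Normal_Form.Determinant"
begin

text \<open>
  The box functions play no role: the identity holds for arbitrary weights that depend on a letter
  and on the diagonal of its cell. Building a tableau box by box, ordered by letter and,
  within a letter, by diagonal, every step is an elementary operation on a configuration of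
  vectors, and the weighted sum over tableaux of a given shape is the minor that belongs to the
  shape. The six rectangles in the identity have minors \<open>[e C \<beta>]\<close>, \<open>[\<gamma> C \<alpha>]\<close>,
  \<open>[C \<beta> \<alpha>]\<close>, \<open>[e \<gamma> C]\<close>, \<open>[e C \<alpha>]\<close> and \<open>[\<gamma> C \<beta>]\<close> with a common block \<open>C\<close>, and the
  identity is the three-term Pluecker relation.
\<close>

section \<open>Determinants as functions of their rows\<close>

text \<open>The six functions are taken at different arguments, so it is not evident that they are
  minors of one configuration. The argument of a box depends on its cell only through the diagonal,
  and diagonals are counted with respect to \<open>n\<close> rows, some of them possibly empty; one
  more row shifts the argument by 2. With a common offset, \<open>\<T> m a (u - 1)\<close>,
  \<open>\<T> (m + 1) a u\<close> and \<open>\<T> m (a - 1) u\<close> belong to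
  \<open>n = a\<close>, the other three to \<open>n = Suc a\<close>, and each product in the
  identity has one factor of each kind. The row \<open>e\<close>, which never changes while boxes
  are added, brings the minors with \<open>a\<close> particles to the size \<open>Suc a\<close> of
  the others.\<close>

definition rdet :: "nat \<Rightarrow> (nat \<Rightarrow> nat \<Rightarrow> 'a::comm_ring_1) \<Rightarrow> 'a" where
  "rdet N c = det (mat N N (\<lambda>(i, j). c i j))"

lemma rdet_cong:
  assumes "\<And>i j. i < N \<Longrightarrow> j < N \<Longrightarrow> c i j = d i j"
  shows "rdet N c = rdet N d"
  unfolding rdet_def by (intro arg_cong[where f = det] eq_matI) (auto simp: assms)

text \<open>Laplace expansion along row \<open>i\<close>: the cofactors delete that row, so a single
  \<open>K\<close> serves all \<open>x\<close>. Linearity in one row is read off from this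
  form.\<close>

lemma rdet_row_functional:
  fixes c :: "nat \<Rightarrow> nat \<Rightarrow> 'a::comm_ring_1"
  assumes "i < N"
  obtains K where "\<And>x. rdet N (c(i := x)) = (\<Sum>j<N. x j * K j)"
proof
  fix x
  let ?A = "mat N N (\<lambda>(k, j). c k j)" and ?B = "mat N N (\<lambda>(k, j). (c(i := x)) k j)"
  have "cofactor ?B i j = cofactor ?A i j" if "j < N" for j
    unfolding cofactor_def mat_delete_def
    by (intro arg_cong[where f = det] arg_cong2[where f = "(*)"] eq_matI)
       (use assms that in auto)
  moreover have "rdet N (c(i := x)) = (\<Sum>j<N. ?B $$ (i, j) * cofactor ?B i j)"
    unfolding rdet_def by (rule laplace_expansion_row) (use assms in auto)
  ultimately show "rdet N (c(i := x)) = (\<Sum>j<N. x j * cofactor ?A i j)"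
    using assms by auto
qed

lemma rdet_linear:
  assumes "i < N"
  shows "rdet N (c(i := \<lambda>j. x j + z * y j)) = rdet N (c(i := x)) + z * rdet N (c(i := y))"
proof -
  obtain K where "\<And>x. rdet N (c(i := x)) = (\<Sum>j<N. x j * K j)"
    using rdet_row_functional[OF assms] by blast
  then show ?thesis
    by (simp add: sum.distrib[symmetric] sum_distrib_left algebra_simps)
qed

lemma rdet_row_sum:
  assumes "i < N"
  shows "rdet N (c(i := \<lambda>j. \<Sum>k\<in>S. q k * x k j)) = (\<Sum>k\<in>S. q k * rdet N (c(i := x k)))"
proof -
  obtain K where "\<And>x. rdet N (c(i := x)) = (\<Sum>j<N. x j * K j)"
    using rdet_row_functional[OF assms] by blast
  then show ?thesis
    by (simp add: sum_distrib_left sum_distrib_right mult.assoc sum.swap[of _ _ S])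
qed

lemma rdet_eq_rows:
  assumes "i < N" "k < N" "i \<noteq> k" "\<And>j. j < N \<Longrightarrow> c i j = c k j"
  shows "rdet N c = 0"
  unfolding rdet_def
  by (rule det_identical_rows[of _ N i k]) (use assms in \<open>auto intro!: eq_vecI\<close>)

lemma rdet_swap:
  assumes "i < N" "k < N" "i \<noteq> k"
  shows "rdet N (c(i := c k, k := c i)) = - rdet N c"
proof -
  have "rdet N (c(i := c k, k := c i)) = det (swaprows i k (mat N N (\<lambda>(i, j). c i j)))"
    unfolding rdet_def
    by (intro arg_cong[where f = det] eq_matI) (use assms in auto)
  also have "\<dots> = - rdet N c"
    unfolding rdet_def by (rule det_swaprows[OF assms mat_carrier])
  finally show ?thesis .
qed

lemma rdet_rows_span:
  fixes c :: "nat \<Rightarrow> nat \<Rightarrow> 'a::field"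
  assumes "rdet N c \<noteq> 0"
  obtains q where "\<And>j. j < N \<Longrightarrow> x j = (\<Sum>i<N. q i * c i j)"
proof -
  define A where "A = mat N N (\<lambda>(i, j). c i j)"
  define D where "D = det A"
  define B where "B = (\<lambda>k i. adj_mat A $$ (k, i))"
  have D: "D \<noteq> 0" using assms by (simp add: rdet_def D_def A_def)
  have A: "A \<in> carrier_mat N N" by (simp add: A_def)
  note adj = adj_mat(1,3)[OF A]
  have e: "(\<Sum>i<N. B k i * c i j) = (if k = j then D else 0)" if "k < N" "j < N" for k j
  proof -
    have "(\<Sum>i<N. B k i * c i j) = (adj_mat A * A) $$ (k, j)"
      using adj(1) that by (auto simp: B_def A_def scalar_prod_def lessThan_atLeast0 intro!: sum.cong)
    also have "\<dots> = (D \<cdot>\<^sub>m 1\<^sub>m N) $$ (k, j)" by (simp only: adj(2) D_def)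
    finally show ?thesis using that by simp
  qed
  show ?thesis
  \<comment> \<open>The coefficients are the row vector \<open>x\<close> times the inverse matrix,
    which is the adjugate divided by \<open>D\<close>.\<close>
  proof (rule that[of "\<lambda>i. \<Sum>k<N. x k / D * B k i"])
    fix j assume j: "j < N"
    have "(\<Sum>i<N. (\<Sum>k<N. x k / D * B k i) * c i j)
        = (\<Sum>i<N. \<Sum>k<N. x k / D * (B k i * c i j))"
      by (simp only: sum_distrib_right mult.assoc)
    also have "\<dots> = (\<Sum>k<N. \<Sum>i<N. x k / D * (B k i * c i j))" by (rule sum.swap)
    also have "\<dots> = (\<Sum>k<N. if k = j then x k else 0)"
      unfolding sum_distrib_left[symmetric] using D j by (intro sum.cong) (auto simp: e)
    also have "\<dots> = x j" using j by simp
    finally show "x j = (\<Sum>i<N. (\<Sum>k<N. x k / D * B k i) * c i j)" by (rule sym)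
  qed
qed

lemma rdet_zero_row:
  assumes "i < N" "\<And>j. j < N \<Longrightarrow> c i j = 0"
  shows "rdet N c = 0"
proof -
  obtain K where "\<And>x. rdet N (c(i := x)) = (\<Sum>j<N. x j * K j)"
    using rdet_row_functional[OF assms(1)] by blast
  from this[of "c i"] show ?thesis by (simp add: assms(2))
qed

lemma rdet_identity: "rdet N (\<lambda>i j. if i = j then 1 else 0) = 1"
  unfolding rdet_def using det_one[of N] by (simp add: one_mat_def)

lemma rdet_rotate_initial:
  assumes "k + n \<le> N"
  shows "rdet N c = (-1) ^ (k * n) *
    rdet N (\<lambda>i. c (if i < n then i + k else if i < k + n then i - n else i))"
proof -
  let ?A = "mat N N (\<lambda>(i, j). c i j)"
  have "mat N N (\<lambda>(i, j). ?A $$ (if i < n then i + k else if i < k + n then i - n else i, j)) =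
      mat N N (\<lambda>(i, j). c (if i < n then i + k else if i < k + n then i - n else i) j)"
    by (rule eq_matI) (use assms in auto)
  then show ?thesis
    unfolding rdet_def using det_swap_initial_rows[of ?A, OF mat_carrier assms] by (simp only:)
qed

lemma rdet_rotate_final:
  assumes "N = l + k + n"
  shows "rdet N c = (-1) ^ (k * n) *
    rdet N (\<lambda>i. c (if i < l then i else if i < l + n then i + k else i - n))"
proof -
  let ?A = "mat N N (\<lambda>(i, j). c i j)"
  have "mat N N (\<lambda>(i, j). ?A $$ (if i < l then i else if i < l + n then i + k else i - n, j)) =
      mat N N (\<lambda>(i, j). c (if i < l then i else if i < l + n then i + k else i - n) j)"
    by (rule eq_matI) (use assms in auto)
  then show ?thesis
    unfolding rdet_def using det_swap_final_rows[of ?A, OF mat_carrier assms] by (simp only:)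
qed

section \<open>The three-term Pluecker relation\<close>

text \<open>Rows 0 and \<open>N\<close> of \<open>C\<close> are overwritten, so the block between
  \<open>x\<close> and \<open>y\<close> consists of rows 1 to \<open>N - 1\<close>; passing a full
  row function avoids an index shift.\<close>

definition border :: "nat \<Rightarrow> (nat \<Rightarrow> nat \<Rightarrow> 'a::comm_ring_1) \<Rightarrow> (nat \<Rightarrow> 'a) \<Rightarrow> (nat \<Rightarrow> 'a) \<Rightarrow> 'a" where
  "border N C x y = rdet (Suc N) (C(0 := x, N := y))"

lemma border_swap: "0 < N \<Longrightarrow> border N C y x = - border N C x y"
  unfolding border_def using rdet_swap[of 0 "Suc N" N "C(0 := x, N := y)"]
  by (simp add: fun_upd_twist)

text \<open>A nonzero bracket makes \<open>x\<close>, the block and \<open>y\<close> a basis. When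
  \<open>c\<close> is expanded in it, a component along a block row repeats that row and drops
  out.\<close>

lemma border_expand:
  fixes C :: "nat \<Rightarrow> nat \<Rightarrow> 'a::field"
  assumes "0 < N" "border N C x y \<noteq> 0"
  obtains p q where "\<And>d. border N C c d = p * border N C x d + q * border N C y d"
proof -
  let ?R = "C(0 := x, N := y)"
  obtain k where k: "\<And>j. j < Suc N \<Longrightarrow> c j = (\<Sum>i<Suc N. k i * ?R i j)"
    using rdet_rows_span[of "Suc N" ?R c] assms(2) unfolding border_def by blast
  show ?thesis
  proof (rule that[of "k 0" "k N"])
    fix d
    have "border N C c d = rdet (Suc N) ((C(N := d))(0 := \<lambda>j. \<Sum>i<Suc N. k i * ?R i j))"
      unfolding border_def using assms(1) by (intro rdet_cong) (auto simp: k)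
    also have "\<dots> = (\<Sum>i<Suc N. k i * rdet (Suc N) ((C(N := d))(0 := ?R i)))"
      by (rule rdet_row_sum) simp
    also have "\<dots> = (\<Sum>i\<in>{0, N}. k i * rdet (Suc N) ((C(N := d))(0 := ?R i)))"
    proof (rule sum.mono_neutral_right)
      show "\<forall>i\<in>{..<Suc N} - {0, N}. k i * rdet (Suc N) ((C(N := d))(0 := ?R i)) = 0"
      proof
        fix i assume "i \<in> {..<Suc N} - {0, N}"
        then have "rdet (Suc N) ((C(N := d))(0 := ?R i)) = 0"
          by (intro rdet_eq_rows[of 0 _ i]) auto
        then show "k i * rdet (Suc N) ((C(N := d))(0 := ?R i)) = 0" by simp
      qed
    qed auto
    also have "\<dots> = k 0 * border N C x d + k N * border N C y d"
      using assms(1) unfolding border_def by (simp add: fun_upd_twist)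
    finally show "border N C c d = k 0 * border N C x d + k N * border N C y d" .
  qed
qed

text \<open>Evaluating the expansion of \<open>c\<close> at \<open>d = x\<close> and
  \<open>d = y\<close> kills one term each time: \<open>q\<close> is \<open>border N C x c\<close>
  and \<open>p\<close> is \<open>- border N C y c\<close>, both divided by
  \<open>border N C x y\<close>.\<close>

lemma border_pluecker_nonzero:
  fixes C :: "nat \<Rightarrow> nat \<Rightarrow> 'a::field"
  assumes "0 < N" "border N C x y \<noteq> 0"
  shows "border N C x y * border N C c d =
    border N C x c * border N C y d - border N C x d * border N C y c"
proof -
  obtain p q where c: "\<And>d. border N C c d = p * border N C x d + q * border N C y d"
    using border_expand[OF assms] by blast
  have "border N C z z = 0" for z
    unfolding border_def by (rule rdet_eq_rows[of 0 _ N]) (use assms(1) in auto)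
  then have "border N C x c = q * border N C x y" "border N C y c = - p * border N C x y"
    using c[of x] c[of y] border_swap[OF assms(1), of C]
    by (metis (no_types) add.right_neutral add.left_neutral mult_zero_right mult_minus_right
        mult_minus_left)+
  then show ?thesis by (simp add: c algebra_simps)
qed

text \<open>Up to signs the relation is symmetric in \<open>y\<close>, \<open>c\<close>,
  \<open>d\<close>, so any nonzero bracket of \<open>x\<close> with one of them can be the divisor;
  if all three vanish, so does every term.\<close>

lemma border_pluecker:
  fixes C :: "nat \<Rightarrow> nat \<Rightarrow> 'a::field"
  assumes "0 < N"
  shows "border N C x y * border N C c d =
    border N C x c * border N C y d - border N C x d * border N C y c"
proof -
  note nz = border_pluecker_nonzero[OF assms] and sw = border_swap[OF assms]
  consider "border N C x y \<noteq> 0" | "border N C x y = 0" "border N C x c \<noteq> 0"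
    | "border N C x y = 0" "border N C x c = 0" "border N C x d \<noteq> 0"
    | "border N C x y = 0" "border N C x c = 0" "border N C x d = 0" by blast
  then show ?thesis
  proof cases
    case 1
    then show ?thesis by (rule nz)
  next
    case 2
    then show ?thesis using nz[of C x c y d] sw[of C y c] by simp
  next
    case 3
    then show ?thesis using nz[of C x d y c] by simp
  qed simp
qed

section \<open>Fillings as sequences of added boxes\<close>

definition cells :: "nat \<Rightarrow> (nat \<Rightarrow> nat) \<Rightarrow> (nat \<times> nat) set" where
  "cells n l = {(i, j). i < n \<and> j < l i}"

definition shape :: "nat \<Rightarrow> (nat \<Rightarrow> nat) \<Rightarrow> bool" where
  "shape n l \<longleftrightarrow> (\<forall>i k. i \<le> k \<and> k < n \<longrightarrow> l k \<le> l i)"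

definition corner :: "nat \<Rightarrow> (nat \<Rightarrow> nat) \<Rightarrow> nat \<Rightarrow> bool" where
  "corner n l i \<longleftrightarrow> i < n \<and> 0 < l i \<and> (Suc i < n \<longrightarrow> l (Suc i) < l i)"

text \<open>
  Entries are the positions \<open>t\<close> in a sequence of boxes to be added, where \<open>\<kappa> t\<close> is the
  diagonal of the \<open>t\<close>-th box. Rows are numbered from 0, and cell \<open>(i, j)\<close> lies on diagonal
  \<open>j + n - Suc i\<close>, so that diagonals are natural numbers; \<open>n\<close> may exceed the number of
  nonempty rows.
\<close>

definition fills :: "(nat \<Rightarrow> nat) \<Rightarrow> nat \<Rightarrow> (nat \<Rightarrow> nat) \<Rightarrow> nat \<Rightarrow> (nat \<times> nat \<Rightarrow> nat) set" where
  "fills \<kappa> n l t = {b \<in> cells n l \<rightarrow>\<^sub>E {..<t}.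
     (\<forall>i j. (i, j) \<in> cells n l \<longrightarrow> \<kappa> (b (i, j)) + Suc i = j + n) \<and>
     (\<forall>i j. (i, Suc j) \<in> cells n l \<longrightarrow> b (i, j) < b (i, Suc j)) \<and>
     (\<forall>i j. (Suc i, j) \<in> cells n l \<longrightarrow> b (i, j) < b (Suc i, j))}"

definition fsum :: "(nat \<Rightarrow> nat) \<Rightarrow> (nat \<Rightarrow> 'a::comm_ring_1) \<Rightarrow> nat \<Rightarrow> (nat \<Rightarrow> nat) \<Rightarrow> nat \<Rightarrow> 'a" where
  "fsum \<kappa> W n l t = (\<Sum>b\<in>fills \<kappa> n l t. \<Prod>c\<in>cells n l. W (b c))"

definition rect :: "nat \<Rightarrow> nat \<Rightarrow> nat \<Rightarrow> nat" where
  "rect a m i = (if i < a then m else 0)"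

lemma shape_rect: "shape n (rect a m)"
  by (auto simp: shape_def rect_def)

lemma finite_cells: "finite (cells n l)"
proof -
  have "cells n l = (SIGMA i:{..<n}. {..<l i})" by (auto simp: cells_def)
  then show ?thesis by simp
qed

lemma cells_up:
  assumes "shape n l" "(Suc i, j) \<in> cells n l"
  shows "(i, j) \<in> cells n l"
proof -
  have "l (Suc i) \<le> l i" using assms by (simp add: shape_def cells_def)
  then show ?thesis using assms(2) by (simp add: cells_def)
qed

lemma finite_fills: "finite (fills \<kappa> n l t)"
  by (rule finite_subset[of _ "cells n l \<rightarrow>\<^sub>E {..<t}"]) (auto simp: fills_def finite_cells finite_PiE)

lemma fills_mono: "fills \<kappa> n l t \<subseteq> fills \<kappa> n l (Suc t)"
  unfolding fills_def PiE_def by (force simp: less_Suc_eq)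

lemma fills_Suc_iff:
  "b \<in> fills \<kappa> n l t \<longleftrightarrow> b \<in> fills \<kappa> n l (Suc t) \<and> (\<forall>c\<in>cells n l. b c \<noteq> t)"
  unfolding fills_def PiE_def Pi_def by (auto simp: less_Suc_eq)

text \<open>\<open>t\<close> is the largest entry available, so strictness leaves no cell to its
  right or below it.\<close>

lemma fills_max_corner:
  assumes "b \<in> fills \<kappa> n l (Suc t)" "(i, j) \<in> cells n l" "b (i, j) = t" "shape n l"
  shows "corner n l i" "Suc j = l i" "\<kappa> t + Suc (Suc i) = l i + n"
proof -
  have le: "b c \<le> t" if "c \<in> cells n l" for c
    using assms(1) that by (cases c) (force simp: fills_def less_Suc_eq_le)
  have 1: "(i, Suc j) \<notin> cells n l" and 2: "(Suc i, j) \<notin> cells n l"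
    using assms(1,3) le[of "(i, Suc j)"] le[of "(Suc i, j)"] unfolding fills_def by fastforce+
  show 3: "Suc j = l i" using 1 assms(2) by (auto simp: cells_def)
  show "corner n l i" using 2 3 assms(2) by (auto simp: cells_def corner_def)
  show "\<kappa> t + Suc (Suc i) = l i + n"
    using assms(1-3) 3 unfolding fills_def by auto
qed

text \<open>The diagonal on which a row ends strictly decreases from row to row. Hence at most one
  row can end with the box \<open>t\<close>.\<close>

lemma shape_content_unique:
  assumes "shape n l" "i < n" "k < n" "x + Suc (Suc i) = l i + n" "x + Suc (Suc k) = l k + n"
  shows "i = k"
proof (rule linorder_cases[of i k])
  assume "i < k"
  then have "l k \<le> l i" using assms(1,3) by (simp add: shape_def)
  with \<open>i < k\<close> show ?thesis using assms(4,5) by linarith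
next
  assume "k < i"
  then have "l i \<le> l k" using assms(1,2) by (simp add: shape_def)
  with \<open>k < i\<close> show ?thesis using assms(4,5) by linarith
qed

lemma fsum_0:
  assumes "shape n l"
  shows "fsum \<kappa> W n l 0 = (if \<forall>i<n. l i = 0 then 1 else 0)"
proof (cases "cells n l = {}")
  case True
  then have "\<forall>i<n. l i = 0" by (auto simp: cells_def)
  moreover have "fills \<kappa> n l 0 = {\<lambda>_. undefined}" using True by (auto simp: fills_def)
  ultimately show ?thesis using True by (simp add: fsum_def)
next
  case False
  then have "\<not> (\<forall>i<n. l i = 0)" by (auto simp: cells_def)
  moreover have "fills \<kappa> n l 0 = {}" using False by (auto simp: fills_def)
  ultimately show ?thesis by (auto simp add: fsum_def)
qed

lemma fsum_Suc_no_corner: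
  assumes "shape n l" "\<And>i. corner n l i \<Longrightarrow> \<kappa> t + Suc (Suc i) \<noteq> l i + n"
  shows "fsum \<kappa> W n l (Suc t) = fsum \<kappa> W n l t"
proof -
  have "b (i, j) \<noteq> t" if "b \<in> fills \<kappa> n l (Suc t)" "(i, j) \<in> cells n l" for b i j
    using fills_max_corner(1,3)[OF that _ assms(1)] assms(2) by blast
  then have "fills \<kappa> n l (Suc t) = fills \<kappa> n l t"
    using fills_mono[of \<kappa> n l t] fills_Suc_iff[of _ \<kappa> n l t]
    by (metis subsetI subset_antisym surj_pair)
  then show ?thesis by (simp add: fsum_def)
qed

lemma cells_remove_corner:
  assumes "corner n l i"
  shows "cells n (l(i := l i - 1)) = cells n l - {(i, l i - 1)}" "(i, l i - 1) \<in> cells n l"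
  using assms by (auto simp: cells_def corner_def split: if_splits)

lemma shape_remove_corner:
  assumes "shape n l" "corner n l i"
  shows "shape n (l(i := l i - 1))"
proof -
  have "l k \<le> l i - 1" if "i < k" "k < n" for k
  proof -
    have "l k \<le> l (Suc i)" using assms(1) that by (auto simp: shape_def)
    then show ?thesis using assms(2) that by (auto simp: corner_def)
  qed
  moreover have "l k - 1 \<le> l k" for k by simp
  ultimately show ?thesis using assms(1) unfolding shape_def
    by (metis fun_upd_apply le_neq_implies_less le_trans order.refl)
qed

lemma fills_add_corner:
  assumes "shape n l" "corner n l i" "\<kappa> t + Suc (Suc i) = l i + n"
  defines "c \<equiv> (i, l i - 1)" and "l' \<equiv> l(i := l i - 1)"
  assumes "b \<in> fills \<kappa> n l' t"
  shows "b(c := t) \<in> fills \<kappa> n l (Suc t)"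
proof -
  have cl: "cells n l = insert c (cells n l')" "c \<notin> cells n l'"
    using cells_remove_corner[OF assms(2)] unfolding c_def l'_def by auto
  have bt: "b x < t" if "x \<in> cells n l'" for x
    using assms(6) that by (auto simp: fills_def)
  have out: "(i, Suc (l i - 1)) \<notin> cells n l" "(Suc i, l i - 1) \<notin> cells n l"
    using assms(2) by (auto simp: cells_def corner_def)
  have left: "(k, j) \<in> cells n l" if "(k, Suc j) \<in> cells n l" for k j
    using that by (auto simp: cells_def)
  have up: "(k, j) \<in> cells n l" if "(Suc k, j) \<in> cells n l" for k j
    using that cells_up[OF assms(1)] by blast
  have mem: "(k, j) \<in> cells n l'" if "(k, j) \<in> cells n l" "(k, j) \<noteq> c" for k j
    using that cl by auto
  show ?thesis
    unfolding fills_def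
  proof (intro CollectI conjI allI impI)
    show "b(c := t) \<in> cells n l \<rightarrow>\<^sub>E {..<Suc t}"
      using assms(6) unfolding cl(1) fills_def PiE_def Pi_def extensional_def by (auto intro: less_SucI)
  next
    fix k j assume "(k, j) \<in> cells n l"
    then show "\<kappa> ((b(c := t)) (k, j)) + Suc k = j + n"
      using mem[of k j] assms(2,3,6) by (auto simp: c_def fills_def corner_def)
  next
    fix k j assume a: "(k, Suc j) \<in> cells n l"
    then have "(k, j) \<noteq> c" using out by (auto simp: c_def)
    then show "(b(c := t)) (k, j) < (b(c := t)) (k, Suc j)"
      using mem[OF a] mem[OF left[OF a]] bt assms(6) by (auto simp: fills_def)
  next
    fix k j assume a: "(Suc k, j) \<in> cells n l"
    then have "(k, j) \<noteq> c" using out by (auto simp: c_def)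
    then show "(b(c := t)) (k, j) < (b(c := t)) (Suc k, j)"
      using mem[OF a] mem[OF up[OF a]] bt assms(6) by (auto simp: fills_def)
  qed
qed

lemma fills_remove_corner:
  assumes "shape n l" "corner n l i" "\<kappa> t + Suc (Suc i) = l i + n"
  defines "c \<equiv> (i, l i - 1)" and "l' \<equiv> l(i := l i - 1)"
  assumes "b \<in> fills \<kappa> n l (Suc t)" "b c = t"
  shows "b(c := undefined) \<in> fills \<kappa> n l' t"
proof -
  have cl: "cells n l = insert c (cells n l')" "c \<notin> cells n l'"
    using cells_remove_corner[OF assms(2)] unfolding c_def l'_def by auto
  have nt: "b (k, j) \<noteq> t" if "(k, j) \<in> cells n l'" for k j
  proof
    assume *: "b (k, j) = t"
    have "(k, j) \<in> cells n l" using that cl by auto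
    note fmc = fills_max_corner[OF assms(6) this * assms(1)]
    then have "k = i"
      using shape_content_unique[OF assms(1) _ _ fmc(3) assms(3)] assms(2) by (auto simp: corner_def)
    then have "(k, j) = c" using fmc(2) by (simp add: c_def)
    then show False using that cl by simp
  qed
  have left: "(k, j) \<in> cells n l'" if "(k, Suc j) \<in> cells n l'" for k j
    using that by (auto simp: cells_def)
  have up: "(k, j) \<in> cells n l'" if "(Suc k, j) \<in> cells n l'" for k j
    using that cells_up[OF shape_remove_corner[OF assms(1,2)]] unfolding l'_def by blast
  show ?thesis
    unfolding fills_def
  proof (intro CollectI conjI allI impI)
    show "b(c := undefined) \<in> cells n l' \<rightarrow>\<^sub>E {..<t}"
    proof (rule PiE_I)
      fix x assume x: "x \<in> cells n l'"
      then have "b x < Suc t" "b x \<noteq> t" using assms(6) cl nt[of "fst x" "snd x"] by (auto simp: fills_def)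
      then show "(b(c := undefined)) x \<in> {..<t}" using x cl(2) by auto
    next
      fix x assume "x \<notin> cells n l'"
      then show "(b(c := undefined)) x = undefined"
        using assms(6) cl(1) PiE_arb[of b "cells n l" _ x] by (auto simp: fills_def)
    qed
  next
    fix k j assume "(k, j) \<in> cells n l'"
    then show "\<kappa> ((b(c := undefined)) (k, j)) + Suc k = j + n"
      using cl assms(6) by (auto simp: fills_def)
  next
    fix k j assume a: "(k, Suc j) \<in> cells n l'"
    then show "(b(c := undefined)) (k, j) < (b(c := undefined)) (k, Suc j)"
      using left[OF a] cl assms(6) by (auto simp: fills_def)
  next
    fix k j assume a: "(Suc k, j) \<in> cells n l'"
    then show "(b(c := undefined)) (k, j) < (b(c := undefined)) (Suc k, j)"
      using up[OF a] cl assms(6) by (auto simp: fills_def)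
  qed
qed

text \<open>Either \<open>t\<close> does not occur, or it sits at the corner of row
  \<open>i\<close>, the only row ending on its diagonal; removing it leaves a filling with entries
  below \<open>t\<close>.\<close>

lemma fsum_Suc_corner:
  assumes "shape n l" "corner n l i" "\<kappa> t + Suc (Suc i) = l i + n"
  shows "fsum \<kappa> W n l (Suc t) = fsum \<kappa> W n l t + W t * fsum \<kappa> W n (l(i := l i - 1)) t"
proof -
  define c where "c = (i, l i - 1)"
  define l' where "l' = l(i := l i - 1)"
  have cl: "cells n l = insert c (cells n l')" "c \<notin> cells n l'"
    using cells_remove_corner[OF assms(2)] unfolding c_def l'_def by auto
  let ?F = "{b \<in> fills \<kappa> n l (Suc t). b c = t}"
  let ?w = "\<lambda>b. \<Prod>x\<in>cells n l. W (b x)"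
  have eq: "fills \<kappa> n l (Suc t) = fills \<kappa> n l t \<union> ?F"
  proof -
    have "b \<in> fills \<kappa> n l t" if b: "b \<in> fills \<kappa> n l (Suc t)" "b c \<noteq> t" for b
    proof -
      have "b (k, j) \<noteq> t" if kj: "(k, j) \<in> cells n l" for k j
      proof
        assume *: "b (k, j) = t"
        note fmc = fills_max_corner[OF b(1) kj * assms(1)]
        have "k = i"
          using fmc(1) assms(2) by (intro shape_content_unique[OF assms(1) _ _ fmc(3) assms(3)])
            (simp_all add: corner_def)
        then have "(k, j) = c" using fmc(2) by (auto simp: c_def)
        with * b(2) show False by simp
      qed
      then have "\<forall>x\<in>cells n l. b x \<noteq> t" by auto
      with b(1) show ?thesis by (simp only: fills_Suc_iff[of b \<kappa> n l t] simp_thms)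
    qed
    then show ?thesis using fills_mono[of \<kappa> n l t] by blast
  qed
  have disj: "fills \<kappa> n l t \<inter> ?F = {}" using cl(1) by (auto simp: fills_def)
  have "fsum \<kappa> W n l (Suc t) = sum ?w (fills \<kappa> n l t \<union> ?F)"
    unfolding fsum_def by (subst eq) simp
  also have "\<dots> = fsum \<kappa> W n l t + sum ?w ?F"
    unfolding fsum_def by (rule sum.union_disjoint[OF finite_fills _ disj]) (simp add: finite_fills)
  also have "sum ?w ?F = (\<Sum>b\<in>fills \<kappa> n l' t. W t * (\<Prod>x\<in>cells n l'. W (b x)))"
  proof (rule sum.reindex_bij_witness[where i = "\<lambda>b. b(c := t)" and j = "\<lambda>b. b(c := undefined)"])
    fix b assume b: "b \<in> ?F"
    then show "(b(c := undefined))(c := t) = b" by auto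
    show "b(c := undefined) \<in> fills \<kappa> n l' t"
      using fills_remove_corner[where b = b and \<kappa> = \<kappa>, OF assms] b unfolding c_def l'_def by auto
    have "(\<Prod>x\<in>cells n l'. W ((b(c := undefined)) x)) = (\<Prod>x\<in>cells n l'. W (b x))"
      by (rule prod.cong) (use cl(2) in auto)
    then show "W t * (\<Prod>x\<in>cells n l'. W ((b(c := undefined)) x)) = ?w b"
      using b cl by (simp add: finite_cells)
  next
    fix b assume b: "b \<in> fills \<kappa> n l' t"
    then have "b c = undefined" using cl(2) PiE_arb[of b "cells n l'" _ c] by (auto simp: fills_def)
    then show "(b(c := t))(c := undefined) = b" by auto
    show "b(c := t) \<in> ?F"
      using fills_add_corner[where b = b and \<kappa> = \<kappa>, OF assms] b unfolding c_def l'_def by auto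
  qed
  finally show ?thesis by (simp add: fsum_def sum_distrib_left l'_def)
qed

section \<open>Evolution of minors while boxes are added\<close>

text \<open>Two determinants are needed, one of them with a fixed extra row. The locale collects
  what the induction over boxes uses, so that it is carried out once.\<close>

locale alternating_form =
  fixes n :: nat and \<Delta> :: "(nat \<Rightarrow> nat \<Rightarrow> 'a::comm_ring_1) \<Rightarrow> 'a"
  assumes row_cong: "(\<And>i. i < n \<Longrightarrow> c i = d i) \<Longrightarrow> \<Delta> c = \<Delta> d"
    and linear: "i < n \<Longrightarrow> \<Delta> (c(i := \<lambda>j. x j + z * y j)) = \<Delta> (c(i := x)) + z * \<Delta> (c(i := y))"
    and alternating: "i < n \<Longrightarrow> k < n \<Longrightarrow> i \<noteq> k \<Longrightarrow> c i = c k \<Longrightarrow> \<Delta> c = 0"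

text \<open>
  A shape \<open>l\<close> with \<open>n\<close> rows corresponds to the particle positions \<open>l i + (n - Suc i)\<close>. Adding
  a box on diagonal \<open>k\<close> moves a particle from \<open>k\<close> to \<open>Suc k\<close>; on the vectors attached to the
  positions this is an elementary operation.
\<close>

fun transfer_vec :: "(nat \<Rightarrow> nat) \<Rightarrow> (nat \<Rightarrow> 'a::comm_ring_1) \<Rightarrow> nat \<Rightarrow> nat \<Rightarrow> nat \<Rightarrow> nat \<Rightarrow> 'a" where
  "transfer_vec \<kappa> W N 0 p = (\<lambda>j. if p + j = N then 1 else 0)"
| "transfer_vec \<kappa> W N (Suc t) p =
    (if p = Suc (\<kappa> t) then \<lambda>j. transfer_vec \<kappa> W N t p j + W t * transfer_vec \<kappa> W N t (\<kappa> t) j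
     else transfer_vec \<kappa> W N t p)"

text \<open>Both sides obey the same recursion in \<open>t\<close>. A row is affected only if its
  particle is at \<open>Suc (\<kappa> t)\<close>, that is, if the row ends on diagonal
  \<open>\<kappa> t\<close>. Linearity then adds the term with this particle at
  \<open>\<kappa> t\<close>, which belongs to the shape without the last box of the row. If that box
  is not removable, the particle meets that of the next row and the added term vanishes.\<close>

lemma (in alternating_form) transfer_eq_fsum:
  assumes base: "\<And>l. shape n l \<Longrightarrow>
      \<Delta> (\<lambda>i. transfer_vec \<kappa> W N 0 (l i + (n - Suc i))) = (if \<forall>i<n. l i = 0 then 1 else 0)"
    and "shape n l"
  shows "\<Delta> (\<lambda>i. transfer_vec \<kappa> W N t (l i + (n - Suc i))) = fsum \<kappa> W n l t"
  using assms(2)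
proof (induction t arbitrary: l)
  case 0
  then show ?case by (simp only: base fsum_0)
next
  case (Suc t)
  let ?V = "transfer_vec \<kappa> W N"
  let ?c = "\<lambda>l i. ?V t (l i + (n - Suc i))"
  show ?case
  proof (cases "\<exists>i<n. \<kappa> t + Suc (Suc i) = l i + n")
    case False
    then have "\<Delta> (\<lambda>i. ?V (Suc t) (l i + (n - Suc i))) = \<Delta> (?c l)"
      by (intro row_cong) auto
    moreover have "fsum \<kappa> W n l (Suc t) = fsum \<kappa> W n l t"
      using False by (intro fsum_Suc_no_corner Suc) (auto simp: corner_def)
    ultimately show ?thesis using Suc by simp
  next
    case True
    then obtain i where i: "i < n" "\<kappa> t + Suc (Suc i) = l i + n" by blast
    have uniq: "k = i" if "k < n" "l k + (n - Suc k) = Suc (\<kappa> t)" for k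
      using shape_content_unique[OF Suc.prems that(1) i(1) _ i(2)] that by simp
    have "\<Delta> (\<lambda>i. ?V (Suc t) (l i + (n - Suc i)))
        = \<Delta> ((?c l)(i := \<lambda>j. ?c l i j + W t * ?V t (\<kappa> t) j))"
    proof (rule row_cong)
      fix k assume "k < n"
      then show "?V (Suc t) (l k + (n - Suc k)) = ((?c l)(i := \<lambda>j. ?c l i j + W t * ?V t (\<kappa> t) j)) k"
        using i uniq[of k] by (cases "l k + (n - Suc k) = Suc (\<kappa> t)") auto
    qed
    also have "\<dots> = \<Delta> (?c l) + W t * \<Delta> ((?c l)(i := ?V t (\<kappa> t)))"
      using linear[OF i(1), of "?c l" "?c l i"] by (simp add: fun_upd_idem)
    finally have *: "\<Delta> (\<lambda>i. ?V (Suc t) (l i + (n - Suc i)))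
        = \<Delta> (?c l) + W t * \<Delta> ((?c l)(i := ?V t (\<kappa> t)))" .
    show ?thesis
    proof (cases "corner n l i")
      case c: True
      then have "l i > 0" by (simp add: corner_def)
      with i have "l i - 1 + (n - Suc i) = \<kappa> t" by simp
      then have "(?c l)(i := ?V t (\<kappa> t)) = ?c (l(i := l i - 1))" by auto
      then have "\<Delta> ((?c l)(i := ?V t (\<kappa> t))) = fsum \<kappa> W n (l(i := l i - 1)) t"
        using Suc.IH[OF shape_remove_corner[OF Suc.prems c]] by (simp only:)
      then show ?thesis
        using * Suc.IH[OF Suc.prems]
          fsum_Suc_corner[where \<kappa> = \<kappa> and W = W, OF Suc.prems c i(2)] by (simp only:)
    next
      case c: False
      have s: "Suc i < n" "l (Suc i) = l i"
      proof -
        \<comment> \<open>In the last row, \<open>i(2)\<close> would force a positive length and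
          thereby a corner.\<close>
        show "Suc i < n" using c i by (auto simp: corner_def)
        then have "l (Suc i) \<le> l i" using Suc.prems by (simp add: shape_def)
        then show "l (Suc i) = l i" using c i(1) by (auto simp: corner_def)
      qed
      then have "l (Suc i) + (n - Suc (Suc i)) = \<kappa> t" using i by simp
      then have "\<Delta> ((?c l)(i := ?V t (\<kappa> t))) = 0"
        using i s by (intro alternating[of i "Suc i"]) auto
      moreover have "fsum \<kappa> W n l (Suc t) = fsum \<kappa> W n l t"
      proof (rule fsum_Suc_no_corner[OF Suc.prems])
        fix k assume k: "corner n l k"
        show "\<kappa> t + Suc (Suc k) \<noteq> l k + n"
        proof
          assume "\<kappa> t + Suc (Suc k) = l k + n"
          then have "k = i"
            using k i(1) by (intro shape_content_unique[OF Suc.prems _ _ _ i(2)]) (simp_all add: corner_def)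
          with k c show False by simp
        qed
      qed
      ultimately show ?thesis using * Suc.IH[OF Suc.prems] by (simp only: mult_zero_right add_0_right)
    qed
  qed
qed

section \<open>Sums over fillings as minors\<close>

lemma alternating_form_rdet: "alternating_form N (rdet N)"
proof
  show "rdet N c = rdet N d" if "\<And>i. i < N \<Longrightarrow> c i = d i" for c d :: "nat \<Rightarrow> nat \<Rightarrow> 'a"
    using that by (intro rdet_cong) simp
qed (auto intro: rdet_linear rdet_eq_rows)

lemma alternating_form_rdet_case_nat: "alternating_form N (\<lambda>c. rdet (Suc N) (case_nat e c))"
proof
  have upd: "case_nat e (c(i := x)) = (case_nat e c)(Suc i := x)" for c i and x :: "nat \<Rightarrow> 'a"
    by (auto split: nat.split)
  show "rdet (Suc N) (case_nat e c) = rdet (Suc N) (case_nat e d)"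
    if "\<And>i. i < N \<Longrightarrow> c i = d i" for c d
    using that by (intro rdet_cong) (auto split: nat.split)
  show "rdet (Suc N) (case_nat e (c(i := \<lambda>j. x j + z * y j))) =
      rdet (Suc N) (case_nat e (c(i := x))) + z * rdet (Suc N) (case_nat e (c(i := y)))"
    if "i < N" for i c x y z
    unfolding upd using that by (intro rdet_linear) simp
  show "rdet (Suc N) (case_nat e c) = 0" if "i < N" "k < N" "i \<noteq> k" "c i = c k" for i k c
    using that by (intro rdet_eq_rows[of "Suc i" _ "Suc k"]) auto
qed

lemma shape_first_pos:
  assumes "shape n l" "\<not> (\<forall>i<n. l i = 0)"
  shows "0 < n" "0 < l 0"
proof -
  obtain i where "i < n" "l i \<noteq> 0" using assms(2) by blast
  moreover from this have "l i \<le> l 0" using assms(1) by (simp add: shape_def)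
  ultimately show "0 < n" "0 < l 0" by auto
qed

text \<open>The initial vector at position \<open>p\<close> is the unit vector with index
  \<open>N - p\<close>, and zero beyond \<open>N\<close>. The empty shape yields the identity
  matrix; any other shape has its first particle beyond \<open>N\<close> and so a zero row.\<close>

lemma rdet_transfer_eq_fsum:
  assumes "shape (Suc N) l"
  shows "rdet (Suc N) (\<lambda>i. transfer_vec \<kappa> W N t (l i + (N - i))) = fsum \<kappa> W (Suc N) l t"
proof -
  interpret alternating_form "Suc N" "rdet (Suc N)" by (rule alternating_form_rdet)
  have "rdet (Suc N) (\<lambda>i. transfer_vec \<kappa> W N 0 (l i + (Suc N - Suc i)))
      = (if \<forall>i<Suc N. l i = 0 then 1 else 0)" if l: "shape (Suc N) l" for l
  proof (cases "\<forall>i<Suc N. l i = 0")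
    case True
    then show ?thesis
      by (subst rdet_identity[of "Suc N", symmetric]) (auto intro!: rdet_cong)
  next
    case False
    from shape_first_pos[OF l False] show ?thesis
      by (subst if_not_P[OF False]) (intro rdet_zero_row[of 0]; simp)
  qed
  from transfer_eq_fsum[OF this assms] show ?thesis by simp
qed

text \<open>With \<open>N\<close> particles the empty shape occupies the positions below
  \<open>N\<close>, whose initial vectors lack only the unit vector with index 0; the extra row
  supplies it.\<close>

lemma rdet_transfer_eq_fsum':
  assumes "shape N l"
  shows "rdet (Suc N) (case_nat (\<lambda>j. if j = 0 then 1 else 0)
      (\<lambda>i. transfer_vec \<kappa> W N t (l i + (N - Suc i)))) = fsum \<kappa> W N l t"
proof -
  let ?e = "\<lambda>j. if j = 0 then 1 else 0"
  interpret alternating_form N "\<lambda>c. rdet (Suc N) (case_nat ?e c)"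
    by (rule alternating_form_rdet_case_nat)
  have "rdet (Suc N) (case_nat ?e (\<lambda>i. transfer_vec \<kappa> W N 0 (l i + (N - Suc i))))
      = (if \<forall>i<N. l i = 0 then 1 else 0)" if l: "shape N l" for l
  proof (cases "\<forall>i<N. l i = 0")
    case True
    then show ?thesis
      by (subst rdet_identity[of "Suc N", symmetric]) (auto intro!: rdet_cong split: nat.split)
  next
    case False
    note pos = shape_first_pos[OF l False]
    have "rdet (Suc N) (case_nat ?e (\<lambda>i. transfer_vec \<kappa> W N 0 (l i + (N - Suc i)))) = 0"
    \<comment> \<open>A first particle at position \<open>N\<close> repeats the extra row; one
      further out carries the zero vector.\<close>
    proof (cases "l 0 = 1")
      case True
      then show ?thesis using pos by (intro rdet_eq_rows[of 0 _ "Suc 0"]) auto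
    next
      case False
      then show ?thesis using pos by (intro rdet_zero_row[of "Suc 0"]) auto
    qed
    with False show ?thesis by simp
  qed
  from transfer_eq_fsum[OF this assms] show ?thesis .
qed

lemma fsum_rect_hirota:
  fixes \<kappa> :: "nat \<Rightarrow> nat" and W :: "nat \<Rightarrow> 'a::field" and t :: nat
  assumes "1 \<le> a" "1 \<le> m"
  defines "F \<equiv> \<lambda>n a m. fsum \<kappa> W n (rect a m) t"
  shows "F a a m * F (Suc a) a m =
    F (Suc a) a (m - 1) * F a a (Suc m) + F a (a - 1) m * F (Suc a) (Suc a) m"
proof -
  \<comment> \<open>All six sums become maximal minors of one configuration of vectors in dimension \<open>Suc a\<close>:
    those with \<open>a\<close> particles get \<open>e\<close> as an additional row.\<close>
  define v where "v = transfer_vec \<kappa> W a t"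
  define e :: "nat \<Rightarrow> 'a" where "e = (\<lambda>j. if j = 0 then 1 else 0)"
  \<comment> \<open>All six configurations occupy positions \<open>m + 1\<close> to
    \<open>m + a - 1\<close>, which form the block. Two of \<open>e\<close>,
    \<open>v (m + a)\<close>, \<open>v m\<close>, \<open>v 0\<close> remain for the outer
    rows.\<close>
  define \<omega> where "\<omega> = border a (\<lambda>i. v (m + a - i))"
  have F1: "F (Suc a) b k = rdet (Suc a) (\<lambda>i. v (rect b k i + (a - i)))" for b k
    unfolding F_def v_def by (rule rdet_transfer_eq_fsum[OF shape_rect, symmetric])
  have F0: "F a b k = rdet (Suc a) (case_nat e (\<lambda>i. v (rect b k i + (a - Suc i))))" for b k
    unfolding F_def v_def e_def by (rule rdet_transfer_eq_fsum'[OF shape_rect, symmetric])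
  have P: "F a a m = \<omega> e (v m)"
    unfolding F0 \<omega>_def border_def
    by (intro rdet_cong) (use assms in \<open>auto simp: rect_def split: nat.split\<close>)
  have Q: "F (Suc a) a m = \<omega> (v (m + a)) (v 0)"
    unfolding F1 \<omega>_def border_def by (intro rdet_cong) (use assms in \<open>auto simp: rect_def\<close>)
  have X: "F (Suc a) (Suc a) m = \<omega> (v (m + a)) (v m)"
    unfolding F1 \<omega>_def border_def by (intro rdet_cong) (use assms in \<open>auto simp: rect_def\<close>)
  have Y: "F a (a - 1) m = \<omega> e (v 0)"
    unfolding F0 \<omega>_def border_def
    by (intro rdet_cong) (use assms in \<open>auto simp: rect_def split: nat.split\<close>)
  \<comment> \<open>Here \<open>v (m + a)\<close> stands before the block and has to pass its
    \<open>a - 1\<close> rows; in \<open>V\<close>, \<open>v m\<close> stands behind the block and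
    passes it the other way. The two signs cancel in the product.\<close>
  have U: "F a a (Suc m) = (-1) ^ (a - 1) * \<omega> e (v (m + a))"
    unfolding F0 \<omega>_def border_def
    using assms by (subst rdet_rotate_final[where l = 1 and k = 1 and n = "a - 1"])
      (auto simp: rect_def Suc_diff_Suc intro!: rdet_cong split: nat.split)
  have V: "F (Suc a) a (m - 1) = (-1) ^ (a - 1) * \<omega> (v m) (v 0)"
    unfolding F1 \<omega>_def border_def
    using assms by (subst rdet_rotate_initial[where k = "a - 1" and n = 1])
      (auto simp: rect_def Suc_diff_Suc intro!: rdet_cong)
  have "(-1 :: 'a) ^ (a - 1) * (-1) ^ (a - 1) = 1"
    by (simp add: power_mult_distrib[symmetric])
  then have "F (Suc a) a (m - 1) * F a a (Suc m) = \<omega> (v m) (v 0) * \<omega> e (v (m + a))"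
    unfolding U V by (simp add: algebra_simps)
  moreover have "\<omega> e (v m) * \<omega> (v (m + a)) (v 0) =
      \<omega> e (v (m + a)) * \<omega> (v m) (v 0) - \<omega> e (v 0) * \<omega> (v m) (v (m + a))"
    unfolding \<omega>_def using assms(1) by (intro border_pluecker) simp
  moreover have "\<omega> (v m) (v (m + a)) = - \<omega> (v (m + a)) (v m)"
    unfolding \<omega>_def using assms(1) by (intro border_swap) simp
  ultimately show ?thesis unfolding P Q X Y by (simp add: algebra_simps)
qed

section \<open>Tableaux as fillings\<close>

lemma digits_less_iff:
  fixes p q u v M :: nat
  assumes "u < M" "v < M"
  shows "p * M + u < q * M + v \<longleftrightarrow> p < q \<or> p = q \<and> u < v"
proof -
  have less: "x * M + y < x' * M + y'" if "x < x'" "y < M" for x x' y y'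
  proof -
    have "x * M + y < Suc x * M" using that by simp
    also have "\<dots> \<le> x' * M" using that by (intro mult_le_mono1) simp
    finally show ?thesis by simp
  qed
  show ?thesis
    using less[of p q u v] less[of q p v u] assms by (cases p q rule: linorder_cases) auto
qed

text \<open>The conditions are disjunctions in order to match \<open>time_less_right\<close> and
  \<open>time_less_down\<close>. Each letter may repeat in exactly one direction, decided by
  \<open>R\<close>; hence one pass through the diagonals per letter suffices.\<close>

definition mixed_tableaux :: "'l::linorder set \<Rightarrow> 'l set \<Rightarrow> nat \<Rightarrow> nat \<Rightarrow> (nat \<times> nat \<Rightarrow> 'l) set" where
  "mixed_tableaux A R a m = {b \<in> {1..a} \<times> {1..m} \<rightarrow>\<^sub>E A.
     (\<forall>i j. 1 \<le> i \<and> i \<le> a \<and> 1 \<le> j \<and> j < m \<longrightarrow>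
        b (i, j) < b (i, Suc j) \<or> b (i, j) = b (i, Suc j) \<and> b (i, j) \<in> R) \<and>
     (\<forall>i j. 1 \<le> i \<and> i < a \<and> 1 \<le> j \<and> j \<le> m \<longrightarrow>
        b (i, j) < b (Suc i, j) \<or> b (i, j) = b (Suc i, j) \<and> b (i, j) \<notin> R)}"

text \<open>
  A letter \<open>x\<close> on diagonal \<open>k\<close> is turned into a time. Within one letter the diagonals run
  upwards if \<open>x\<close> may be repeated in rows and downwards if it may be repeated in columns; then
  both kinds of tableau conditions become strict inequalities between times.
\<close>

locale letter_times =
  fixes h :: "nat \<Rightarrow> 'l::linorder" and L M :: nat and A R :: "'l set"
  assumes bij: "bij_betw h {..<L} A" and mono: "strict_mono_on {..<L} h"
begin

definition flip :: "'l \<Rightarrow> nat \<Rightarrow> nat" where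
  "flip x k = (if x \<in> R then k else M - Suc k)"

definition time :: "'l \<Rightarrow> nat \<Rightarrow> nat" where
  "time x k = the_inv_into {..<L} h x * M + flip x k"

definition letter_at :: "nat \<Rightarrow> 'l" where
  "letter_at t = h (t div M)"

text \<open>\<open>flip x\<close> is an involution on the diagonals below \<open>M\<close>, so the
  same map decodes.\<close>

definition content_at :: "nat \<Rightarrow> nat" where
  "content_at t = flip (letter_at t) (t mod M)"

lemma flip_less: "k < M \<Longrightarrow> flip x k < M"
  and flip_flip: "k < M \<Longrightarrow> flip x (flip x k) = k"
  by (auto simp: flip_def)

lemma pos_less: "the_inv_into {..<L} h x < L" if "x \<in> A"
  using bij the_inv_into_into[of h "{..<L}" x "{..<L}"] that by (simp add: bij_betw_def)

lemma h_pos: "x \<in> A \<Longrightarrow> h (the_inv_into {..<L} h x) = x"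
  by (rule f_the_inv_into_f_bij_betw[OF bij]) simp

lemma pos_h: "p < L \<Longrightarrow> the_inv_into {..<L} h (h p) = p"
  using bij by (intro the_inv_into_f_f) (auto simp: bij_betw_def)

lemma pos_less_iff:
  assumes "x \<in> A" "y \<in> A"
  shows "the_inv_into {..<L} h x < the_inv_into {..<L} h y \<longleftrightarrow> x < y"
  using strict_mono_on_less[OF mono, of "the_inv_into {..<L} h x" "the_inv_into {..<L} h y"]
    assms by (simp add: pos_less h_pos)

lemma pos_eq_iff:
  assumes "x \<in> A" "y \<in> A"
  shows "the_inv_into {..<L} h x = the_inv_into {..<L} h y \<longleftrightarrow> x = y"
proof
  assume "the_inv_into {..<L} h x = the_inv_into {..<L} h y"
  then have "h (the_inv_into {..<L} h x) = h (the_inv_into {..<L} h y)" by (rule arg_cong)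
  then show "x = y" by (simp only: h_pos assms)
qed simp

lemma time_less:
  assumes "x \<in> A" "k < M"
  shows "time x k < L * M"
  using digits_less_iff[of "flip x k" M 0 "the_inv_into {..<L} h x" L] assms
  by (simp add: time_def flip_less pos_less)

lemma letter_at_time: "x \<in> A \<Longrightarrow> k < M \<Longrightarrow> letter_at (time x k) = x"
  by (simp add: letter_at_def time_def flip_less h_pos)

lemma content_at_time: "x \<in> A \<Longrightarrow> k < M \<Longrightarrow> content_at (time x k) = k"
  by (simp add: content_at_def letter_at_time) (simp add: time_def flip_less flip_flip)

lemma
  assumes "t < L * M"
  shows letter_at_in: "letter_at t \<in> A"
    and time_at: "time (letter_at t) (content_at t) = t"
proof -
  have M: "0 < M" using assms by (cases M) auto
  have d: "t div M < L" using assms by (simp add: less_mult_imp_div_less)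
  then show "letter_at t \<in> A" using bij by (auto simp: letter_at_def bij_betw_def)
  show "time (letter_at t) (content_at t) = t"
    using M d by (simp add: content_at_def time_def flip_flip) (simp add: letter_at_def pos_h)
qed

text \<open>A step to the right raises the diagonal by one and a step down lowers it, whence the
  different places of \<open>Suc k\<close> here and in \<open>time_less_down\<close>.\<close>

lemma time_less_right:
  assumes "x \<in> A" "y \<in> A" "Suc k < M"
  shows "time x k < time y (Suc k) \<longleftrightarrow> x < y \<or> x = y \<and> x \<in> R"
proof -
  have "time x k < time y (Suc k) \<longleftrightarrow> x < y \<or> x = y \<and> flip x k < flip y (Suc k)"
    using assms unfolding time_def
    by (subst digits_less_iff) (simp_all add: flip_less pos_less_iff pos_eq_iff)
  moreover have "flip x k < flip x (Suc k) \<longleftrightarrow> x \<in> R" using assms(3) by (auto simp: flip_def)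
  ultimately show ?thesis by auto
qed

lemma time_less_down:
  assumes "x \<in> A" "y \<in> A" "Suc k < M"
  shows "time x (Suc k) < time y k \<longleftrightarrow> x < y \<or> x = y \<and> x \<notin> R"
proof -
  have "time x (Suc k) < time y k \<longleftrightarrow> x < y \<or> x = y \<and> flip x (Suc k) < flip y k"
    using assms unfolding time_def
    by (subst digits_less_iff) (simp_all add: flip_less pos_less_iff pos_eq_iff)
  moreover have "flip x (Suc k) < flip x k \<longleftrightarrow> x \<notin> R" using assms(3) by (auto simp: flip_def)
  ultimately show ?thesis by auto
qed

text \<open>Tableau cells are numbered from 1, those of \<open>cells\<close> from 0. Restricting
  makes the two translations mutually inverse on extensional functions.\<close>

definition to_times :: "nat \<Rightarrow> (nat \<times> nat) set \<Rightarrow> (nat \<times> nat \<Rightarrow> 'l) \<Rightarrow> nat \<times> nat \<Rightarrow> nat" where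
  "to_times n C b = restrict (\<lambda>(i, j). time (b (Suc i, Suc j)) (j + n - Suc i)) C"

definition of_times :: "(nat \<times> nat) set \<Rightarrow> (nat \<times> nat \<Rightarrow> nat) \<Rightarrow> nat \<times> nat \<Rightarrow> 'l" where
  "of_times D b = restrict (\<lambda>(i, j). letter_at (b (i - 1, j - 1))) D"

context
  fixes a m n :: nat
  assumes an: "a \<le> n" and mn: "m + n \<le> Suc M"
begin

lemma cells_rect: "cells n (rect a m) = {..<a} \<times> {..<m}"
  using an by (auto simp: cells_def rect_def split: if_splits)

text \<open>The largest diagonal, at the end of the first row, is \<open>m + n - 2\<close>; the
  bound on \<open>m + n\<close> keeps it below \<open>M\<close>.\<close>

lemma content_less: "i < a \<Longrightarrow> j < m \<Longrightarrow> j + n - Suc i < M"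
  using an mn by linarith

lemma to_times_in_fills:
  assumes "b \<in> mixed_tableaux A R a m"
  shows "to_times n ({..<a} \<times> {..<m}) b \<in> fills content_at n (rect a m) (L * M)"
proof -
  have bA: "b (Suc i, Suc j) \<in> A" if "i < a" "j < m" for i j
    using assms that by (auto simp: mixed_tableaux_def)
  show ?thesis
    unfolding fills_def cells_rect
  proof (intro CollectI conjI allI impI)
    show "to_times n ({..<a} \<times> {..<m}) b \<in> {..<a} \<times> {..<m} \<rightarrow>\<^sub>E {..<L * M}"
      by (auto simp: to_times_def time_less bA content_less)
  next
    fix i j assume "(i, j) \<in> {..<a} \<times> {..<m}"
    then show "content_at (to_times n ({..<a} \<times> {..<m}) b (i, j)) + Suc i = j + n"
      using an by (simp add: to_times_def content_at_time bA content_less)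
  next
    fix i j assume ij: "(i, Suc j) \<in> {..<a} \<times> {..<m}"
    then have "Suc j + n - Suc i = Suc (j + n - Suc i)" using an by auto
    then show "to_times n ({..<a} \<times> {..<m}) b (i, j) < to_times n ({..<a} \<times> {..<m}) b (i, Suc j)"
      using ij assms content_less[of i "Suc j"]
      by (simp add: to_times_def time_less_right bA mixed_tableaux_def)
  next
    fix i j assume ij: "(Suc i, j) \<in> {..<a} \<times> {..<m}"
    then have "j + n - Suc i = Suc (j + n - Suc (Suc i))" using an by auto
    then show "to_times n ({..<a} \<times> {..<m}) b (i, j) < to_times n ({..<a} \<times> {..<m}) b (Suc i, j)"
      using ij assms content_less[of i j]
      by (simp add: to_times_def time_less_down bA mixed_tableaux_def)
  qed
qed

lemma fills_rectD:
  assumes "b \<in> fills content_at n (rect a m) (L * M)" "i < a" "j < m"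
  shows "b (i, j) < L * M" "content_at (b (i, j)) = j + n - Suc i"
    "time (letter_at (b (i, j))) (j + n - Suc i) = b (i, j)"
proof -
  show lt: "b (i, j) < L * M" using assms by (auto simp: fills_def cells_rect)
  have "content_at (b (i, j)) + Suc i = j + n" using assms by (simp add: fills_def cells_rect)
  then show c: "content_at (b (i, j)) = j + n - Suc i" by linarith
  show "time (letter_at (b (i, j))) (j + n - Suc i) = b (i, j)"
    using time_at[OF lt] c by simp
qed

lemma of_times_in_tableaux:
  assumes "b \<in> fills content_at n (rect a m) (L * M)"
  shows "of_times ({1..a} \<times> {1..m}) b \<in> mixed_tableaux A R a m"
proof -
  note bD = fills_rectD[OF assms]
  have row: "b (i, j) < b (i, Suc j)" if "i < a" "Suc j < m" for i j
    using assms that by (simp add: fills_def cells_rect)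
  have col: "b (i, j) < b (Suc i, j)" if "Suc i < a" "j < m" for i j
    using assms that by (simp add: fills_def cells_rect)
  show ?thesis
    unfolding mixed_tableaux_def
  proof (intro CollectI conjI allI impI)
    show "of_times ({1..a} \<times> {1..m}) b \<in> {1..a} \<times> {1..m} \<rightarrow>\<^sub>E A"
      by (auto simp: of_times_def intro!: letter_at_in bD)
  next
    fix i j assume ij: "1 \<le> i \<and> i \<le> a \<and> 1 \<le> j \<and> j < m"
    define i' j' where "i' = i - 1" and "j' = j - 1"
    have i': "i = Suc i'" "j = Suc j'" "i' < a" "Suc j' < m" using ij by (auto simp: i'_def j'_def)
    have e: "Suc j' + n - Suc i' = Suc (j' + n - Suc i')" using i' an by auto
    have ia: "i' < a" "j' < m" using i' by auto
    have A: "letter_at (b (i', j')) \<in> A" "letter_at (b (i', Suc j')) \<in> A"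
      using bD(1) i' by (auto intro!: letter_at_in)
    have "time (letter_at (b (i', j'))) (j' + n - Suc i')
        < time (letter_at (b (i', Suc j'))) (Suc (j' + n - Suc i'))"
      using row[OF i'(3,4)] bD(3)[OF ia] bD(3)[OF i'(3,4), unfolded e] by (simp only:)
    then have "letter_at (b (i', j')) < letter_at (b (i', Suc j')) \<or>
        letter_at (b (i', j')) = letter_at (b (i', Suc j')) \<and> letter_at (b (i', j')) \<in> R"
      using time_less_right[OF A] content_less[OF i'(3,4), unfolded e] by blast
    then show "of_times ({1..a} \<times> {1..m}) b (i, j) < of_times ({1..a} \<times> {1..m}) b (i, Suc j) \<or>
        of_times ({1..a} \<times> {1..m}) b (i, j) = of_times ({1..a} \<times> {1..m}) b (i, Suc j) \<and>
        of_times ({1..a} \<times> {1..m}) b (i, j) \<in> R"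
      using i' by (simp add: of_times_def)
  next
    fix i j assume ij: "1 \<le> i \<and> i < a \<and> 1 \<le> j \<and> j \<le> m"
    define i' j' where "i' = i - 1" and "j' = j - 1"
    have i': "i = Suc i'" "j = Suc j'" "Suc i' < a" "j' < m" using ij by (auto simp: i'_def j'_def)
    have e: "j' + n - Suc i' = Suc (j' + n - Suc (Suc i'))" using i' an by auto
    have ia: "i' < a" "j' < m" using i' by auto
    have A: "letter_at (b (i', j')) \<in> A" "letter_at (b (Suc i', j')) \<in> A"
      using bD(1) i' by (auto intro!: letter_at_in)
    have "time (letter_at (b (i', j'))) (Suc (j' + n - Suc (Suc i')))
        < time (letter_at (b (Suc i', j'))) (j' + n - Suc (Suc i'))"
      using col[OF i'(3,4)] bD(3)[OF ia, unfolded e] bD(3)[OF i'(3,4)] by (simp only:)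
    then have "letter_at (b (i', j')) < letter_at (b (Suc i', j')) \<or>
        letter_at (b (i', j')) = letter_at (b (Suc i', j')) \<and> letter_at (b (i', j')) \<notin> R"
      using time_less_down[OF A] content_less[OF ia, unfolded e] by blast
    then show "of_times ({1..a} \<times> {1..m}) b (i, j) < of_times ({1..a} \<times> {1..m}) b (Suc i, j) \<or>
        of_times ({1..a} \<times> {1..m}) b (i, j) = of_times ({1..a} \<times> {1..m}) b (Suc i, j) \<and>
        of_times ({1..a} \<times> {1..m}) b (i, j) \<notin> R"
      using i' by (simp add: of_times_def)
  qed
qed

lemma of_times_to_times:
  assumes "b \<in> mixed_tableaux A R a m"
  shows "of_times ({1..a} \<times> {1..m}) (to_times n ({..<a} \<times> {..<m}) b) = b"
proof (rule extensionalityI[of _ "{1..a} \<times> {1..m}"])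
  show "b \<in> extensional ({1..a} \<times> {1..m})"
    using assms by (simp add: mixed_tableaux_def PiE_def)
next
  fix x assume x: "x \<in> {1..a} \<times> {1..m}"
  then obtain i j where ij: "x = (Suc i, Suc j)" "i < a" "j < m"
    by (cases x; cases "fst x"; cases "snd x") auto
  have "b x \<in> A" using assms x by (auto simp: mixed_tableaux_def)
  with x show "of_times ({1..a} \<times> {1..m}) (to_times n ({..<a} \<times> {..<m}) b) x = b x"
    by (simp add: ij of_times_def to_times_def letter_at_time content_less)
qed (simp add: of_times_def)

lemma to_times_of_times:
  assumes "b \<in> fills content_at n (rect a m) (L * M)"
  shows "to_times n ({..<a} \<times> {..<m}) (of_times ({1..a} \<times> {1..m}) b) = b"
proof (rule extensionalityI[of _ "{..<a} \<times> {..<m}"])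
  show "b \<in> extensional ({..<a} \<times> {..<m})"
    using assms by (simp add: fills_def cells_rect PiE_def)
next
  fix x assume x: "x \<in> {..<a} \<times> {..<m}"
  then obtain i j where ij: "x = (i, j)" "i < a" "j < m" by auto
  with x show "to_times n ({..<a} \<times> {..<m}) (of_times ({1..a} \<times> {1..m}) b) x = b x"
    by (simp add: of_times_def to_times_def fills_rectD(3)[OF assms])
qed (simp add: to_times_def)

lemma sum_mixed_tableaux_eq_fsum:
  fixes f :: "'l \<Rightarrow> nat \<Rightarrow> 'a::comm_ring_1"
  shows "(\<Sum>b\<in>mixed_tableaux A R a m. \<Prod>i=1..a. \<Prod>j=1..m. f (b (i, j)) (j + n - Suc i)) =
    fsum content_at (\<lambda>t. f (letter_at t) (content_at t)) n (rect a m) (L * M)"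
  unfolding fsum_def
proof (rule sum.reindex_bij_witness[where i = "of_times ({1..a} \<times> {1..m})"
      and j = "to_times n ({..<a} \<times> {..<m})"])
  fix b assume b: "b \<in> mixed_tableaux A R a m"
  show "of_times ({1..a} \<times> {1..m}) (to_times n ({..<a} \<times> {..<m}) b) = b"
    by (rule of_times_to_times[OF b])
  show "to_times n ({..<a} \<times> {..<m}) b \<in> fills content_at n (rect a m) (L * M)"
    by (rule to_times_in_fills[OF b])
  let ?b = "to_times n ({..<a} \<times> {..<m}) b"
  have "(\<Prod>c\<in>cells n (rect a m). f (letter_at (?b c)) (content_at (?b c)))
      = (\<Prod>i<a. \<Prod>j<m. f (letter_at (?b (i, j))) (content_at (?b (i, j))))"
    unfolding cells_rect by (simp add: prod.cartesian_product)
  also have "\<dots> = (\<Prod>i<a. \<Prod>j<m. f (b (Suc i, Suc j)) (Suc j + n - Suc (Suc i)))"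
  proof (intro prod.cong refl)
    fix i j assume ij: "i \<in> {..<a}" "j \<in> {..<m}"
    then have "b (Suc i, Suc j) \<in> A" using b by (auto simp: mixed_tableaux_def)
    with ij show "f (letter_at (?b (i, j))) (content_at (?b (i, j))) =
        f (b (Suc i, Suc j)) (Suc j + n - Suc (Suc i))"
      by (simp add: to_times_def letter_at_time content_at_time content_less)
  qed
  also have "\<dots> = (\<Prod>i=1..a. \<Prod>j=1..m. f (b (i, j)) (j + n - Suc i))"
    by (simp add: prod.atLeast1_atMost_eq)
  finally show "(\<Prod>c\<in>cells n (rect a m). f (letter_at (?b c)) (content_at (?b c))) =
      (\<Prod>i=1..a. \<Prod>j=1..m. f (b (i, j)) (j + n - Suc i))" .
next
  fix b assume b: "b \<in> fills content_at n (rect a m) (L * M)"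
  show "to_times n ({..<a} \<times> {..<m}) (of_times ({1..a} \<times> {1..m}) b) = b"
    by (rule to_times_of_times[OF b])
  show "of_times ({1..a} \<times> {1..m}) b \<in> mixed_tableaux A R a m"
    by (rule of_times_in_tableaux[OF b])
qed

end

end

section \<open>The functions $\mathcal{T}_m^a$\<close>

text \<open>\<open>Ze\<close> lies in \<open>J_plus\<close> but repeats like a letter of
  \<open>J_minus\<close>, along columns only.\<close>

lemma J_row_letters:
  assumes "x \<in> J r s"
  shows "x \<in> J_minus s \<union> {Ze} \<longleftrightarrow> x \<notin> J_plus r s - {Ze}"
  using assms by (auto simp: J_def J_minus_def J_plus_def)

lemma tableaux_eq_mixed_tableaux:
  "tableaux r s m a = mixed_tableaux (J r s) (J_plus r s - {Ze}) a m"
proof -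
  have *: "((\<forall>i\<in>{1..a}. \<forall>j. 1 \<le> j \<and> j + 1 \<le> m \<longrightarrow>
        b (i, j) \<le> b (i, j+1) \<and> (b (i, j) \<in> J_minus s \<union> {Ze} \<longrightarrow> b (i, j) < b (i, j+1))) \<and>
      (\<forall>j\<in>{1..m}. \<forall>i. 1 \<le> i \<and> i + 1 \<le> a \<longrightarrow>
        b (i, j) \<le> b (i+1, j) \<and> (b (i, j) \<in> J_plus r s - {Ze} \<longrightarrow> b (i, j) < b (i+1, j)))) \<longleftrightarrow>
    ((\<forall>i j. 1 \<le> i \<and> i \<le> a \<and> 1 \<le> j \<and> j < m \<longrightarrow>
        b (i, j) < b (i, Suc j) \<or> b (i, j) = b (i, Suc j) \<and> b (i, j) \<in> J_plus r s - {Ze}) \<and>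
     (\<forall>i j. 1 \<le> i \<and> i < a \<and> 1 \<le> j \<and> j \<le> m \<longrightarrow>
        b (i, j) < b (Suc i, j) \<or> b (i, j) = b (Suc i, j) \<and> b (i, j) \<notin> J_plus r s - {Ze}))"
    if b: "b \<in> {1..a} \<times> {1..m} \<rightarrow>\<^sub>E J r s" for b
  proof -
    have bJ: "b (i, j) \<in> J_minus s \<union> {Ze} \<longleftrightarrow> b (i, j) \<notin> J_plus r s - {Ze}"
      if "i \<in> {1..a}" "j \<in> {1..m}" for i j
      using b that by (intro J_row_letters) auto
    have 1: "b (i, j) \<le> b (i, j+1) \<and> (b (i, j) \<in> J_minus s \<union> {Ze} \<longrightarrow> b (i, j) < b (i, j+1))
      \<longleftrightarrow> b (i, j) < b (i, Suc j) \<or> b (i, j) = b (i, Suc j) \<and> b (i, j) \<in> J_plus r s - {Ze}"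
      if "1 \<le> i \<and> i \<le> a \<and> 1 \<le> j \<and> j < m" for i j
    proof -
      have "b (i, j) \<in> J_minus s \<union> {Ze} \<longleftrightarrow> b (i, j) \<notin> J_plus r s - {Ze}"
        using that by (intro bJ) auto
      then show ?thesis unfolding le_less Suc_eq_plus1 by blast
    qed
    have 2: "b (i, j) \<le> b (i+1, j) \<and> (b (i, j) \<in> J_plus r s - {Ze} \<longrightarrow> b (i, j) < b (i+1, j))
      \<longleftrightarrow> b (i, j) < b (Suc i, j) \<or> b (i, j) = b (Suc i, j) \<and> b (i, j) \<notin> J_plus r s - {Ze}" for i j
      unfolding le_less Suc_eq_plus1 by auto
    show ?thesis
      unfolding 2 using 1 by (simp add: Suc_le_eq Ball_def) blast
  qed
  show ?thesis
    unfolding tableaux_def mixed_tableaux_def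
    by (rule Collect_cong, rule conj_cong[OF refl], rule *)
qed

lemma letter_times_sorted_list:
  fixes A :: "'l::linorder set"
  assumes "finite A"
  shows "letter_times ((!) (sorted_list_of_set A)) (card A) A"
proof
  show "bij_betw ((!) (sorted_list_of_set A)) {..<card A} A"
    using assms by (intro bij_betw_nth) auto
  show "strict_mono_on {..<card A} ((!) (sorted_list_of_set A))"
    by (auto simp: strict_mono_on_def intro: sorted_wrt_nth_less[OF strict_sorted_list_of_set])
qed

text \<open>The second assumption makes the argument of every box a function of its diagonal with
  offset \<open>c\<close>. Adjusting \<open>n\<close> lets rectangles of different sizes and shifts
  share one \<open>c\<close>.\<close>

lemma T_eq_sum_mixed_tableaux:
  assumes "a \<le> n" "u' - of_nat m + of_nat a = c + 2 * of_nat n"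
  shows "T \<Phi> N w p v r s m a u' = (\<Sum>b\<in>mixed_tableaux (J r s) (J_plus r s - {Ze}) a m.
    \<Prod>i=1..a. \<Prod>j=1..m. (\<lambda>x k. (-1) ^ parity s x * boxfun \<Phi> N w p v r s x (c + 2 + 2 * of_nat k))
      (b (i, j)) (j + n - Suc i))"
proof (cases "m = 0 \<or> a = 0")
  case True
  \<comment> \<open>The convention that an empty rectangle contributes 1 agrees with its single
    empty tableau, of weight 1.\<close>
  then have "mixed_tableaux (J r s) (J_plus r s - {Ze}) a m = {\<lambda>_. undefined}"
    by (auto simp: mixed_tableaux_def)
  with True show ?thesis by (auto simp: T_def)
next
  case False
  have arg: "u' - of_nat m + of_nat a - 2 * of_nat i + 2 * of_nat j =
      c + 2 + 2 * of_nat (j + n - Suc i)" if "i \<in> {1..a}" "j \<in> {1..m}" for i j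
  proof -
    have "of_nat (j + n - Suc i) = (of_nat j + of_nat n - of_nat (Suc i) :: complex)"
      using that assms(1) by (subst of_nat_diff) auto
    then show ?thesis unfolding assms(2) by (simp only:) (simp add: algebra_simps)
  qed
  show ?thesis
    unfolding T_def tableaux_eq_mixed_tableaux if_not_P[OF False]
    by (intro sum.cong prod.cong refl) (simp only: arg)
qed

lemma T_hirota:
  fixes \<Phi> :: "complex \<Rightarrow> complex" and N :: nat and w :: "nat \<Rightarrow> complex"
    and p :: "nat \<Rightarrow> nat" and v :: "nat \<Rightarrow> nat \<Rightarrow> complex" and r s m a :: nat and u :: complex
  assumes "1 \<le> m" "1 \<le> a"
  defines "\<T> \<equiv> T \<Phi> N w p v r s"
  shows "\<T> m a (u - 1) * \<T> m a (u + 1) =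
    \<T> (m - 1) a u * \<T> (m + 1) a u + \<T> m (a - 1) u * \<T> m (a + 1) u"
proof -
  \<comment> \<open>Solves \<open>u - 1 - m + a = c + 2 * a\<close>, the matching condition for the
    first factor with \<open>n = a\<close>; the other five then match with \<open>n = a\<close> or
    \<open>n = Suc a\<close>.\<close>
  define c where "c = u - 1 - of_nat m - of_nat a"
  define h where "h = (!) (sorted_list_of_set (J r s))"
  define L where "L = card (J r s)"
  define R where "R = J_plus r s - {Ze}"
  have "finite (J r s)" by (simp add: J_def J_plus_def J_minus_def)
  \<comment> \<open>The largest diagonal is \<open>m + a - 1\<close>, reached for width
    \<open>m + 1\<close> with \<open>n = a\<close> and for width \<open>m\<close> with
    \<open>n = Suc a\<close>, so \<open>m + a\<close> diagonals suffice.\<close>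
  then interpret letter_times h L "m + a" "J r s" R
    unfolding h_def L_def by (rule letter_times_sorted_list)
  define F where "F = (\<lambda>n b k. fsum content_at
    (\<lambda>t. (-1) ^ parity s (letter_at t) *
      boxfun \<Phi> N w p v r s (letter_at t) (c + 2 + 2 * of_nat (content_at t))) n (rect b k) (L * (m + a)))"
  have T: "\<T> k b u' = F n b k"
    if "u' - of_nat k + of_nat b = c + 2 * of_nat n" "b \<le> n" "k + n \<le> Suc (m + a)" for u' k b n
    unfolding \<T>_def T_eq_sum_mixed_tableaux[OF that(2,1)] F_def R_def[symmetric]
    by (rule sum_mixed_tableaux_eq_fsum[OF that(2,3)])
  have "F a a m * F (Suc a) a m =
      F (Suc a) a (m - 1) * F a a (Suc m) + F a (a - 1) m * F (Suc a) (Suc a) m"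
    unfolding F_def by (rule fsum_rect_hirota[OF assms(2,1)])
  moreover have "\<T> m a (u - 1) = F a a m" "\<T> m a (u + 1) = F (Suc a) a m"
    "\<T> (m - 1) a u = F (Suc a) a (m - 1)" "\<T> (Suc m) a u = F a a (Suc m)"
    "\<T> m (a - 1) u = F a (a - 1) m" "\<T> m (Suc a) u = F (Suc a) (Suc a) m"
    by (rule T; use assms(1,2) in \<open>simp add: c_def of_nat_diff algebra_simps\<close>)+
  ultimately show ?thesis by simp
qed

section \<open>Meromorphy of both sides\<close>

lemma meromorphic_on_entire_compose:
  assumes "f holomorphic_on UNIV" "g holomorphic_on UNIV"
  shows "(\<lambda>u. f (g u)) meromorphic_on UNIV"
proof -
  have "f \<circ> g holomorphic_on UNIV"
    using assms by (intro holomorphic_on_compose) (auto intro: holomorphic_on_subset)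
  then show ?thesis
    by (intro analytic_on_imp_meromorphic_on) (simp add: analytic_on_open o_def)
qed

context
  fixes \<Phi> :: "complex \<Rightarrow> complex"
  assumes \<Phi>: "\<Phi> holomorphic_on UNIV"
begin

lemma entire_shift: "(\<lambda>u. \<Phi> (u - z)) holomorphic_on UNIV"
proof -
  have "(\<lambda>u. u - z) holomorphic_on UNIV" by (intro holomorphic_intros)
  from holomorphic_on_compose_gen[OF this \<Phi>] show ?thesis by (simp add: o_def)
qed

lemma Qfun_holomorphic: "Qfun \<Phi> n v a holomorphic_on UNIV"
  unfolding Qfun_def by (cases "a = 0") (auto intro!: holomorphic_intros entire_shift)

lemma phi_holomorphic: "phi \<Phi> N w holomorphic_on UNIV"
  unfolding phi_def by (auto intro!: holomorphic_intros entire_shift)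

lemma boxfun_meromorphic: "(\<lambda>u. boxfun \<Phi> N w n v r s c (u + z)) meromorphic_on UNIV"
proof -
  have Q: "(\<lambda>u. Qfun \<Phi> n v a (g u)) meromorphic_on UNIV" if "g holomorphic_on UNIV" for a g
    by (rule meromorphic_on_entire_compose[OF Qfun_holomorphic that])
  have P: "(\<lambda>u. phi \<Phi> N w (g u)) meromorphic_on UNIV" if "g holomorphic_on UNIV" for g
    by (rule meromorphic_on_entire_compose[OF phi_holomorphic that])
  have psi: "(\<lambda>u. psi \<Phi> N w r s c (u + z)) meromorphic_on UNIV" for c
    unfolding psi_def Let_def
    by (cases "c = Pl 1"; cases "c = Br 1")
      (auto intro!: meromorphic_on_mult P holomorphic_intros)
  note mero = psi meromorphic_on_mult meromorphic_on_divide Q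
  show ?thesis
  proof (cases c)
    case (Pl a)
    then show ?thesis unfolding boxfun_def Let_def
      by (cases "a \<le> s") (auto intro!: mero holomorphic_intros)
  next
    case Ze
    then show ?thesis unfolding boxfun_def Let_def
      by (auto intro!: mero holomorphic_intros)
  next
    case (Br a)
    then show ?thesis unfolding boxfun_def Let_def
      by (cases "a \<le> s") (auto intro!: mero holomorphic_intros)
  qed
qed

lemma T_meromorphic: "(\<lambda>u. T \<Phi> N w n v r s m a (u + z)) meromorphic_on UNIV"
proof (cases "m = 0 \<or> a = 0")
  case False
  have "(\<lambda>u. boxfun \<Phi> N w n v r s c (u + z - x + y - i + j)) meromorphic_on UNIV" for c x y i j
    using boxfun_meromorphic[of N w n v r s c "z - x + y - i + j"] by (simp add: algebra_simps)
  with False show ?thesis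
    unfolding T_def
    by (auto intro!: meromorphic_on_sum meromorphic_on_prod meromorphic_on_mult)
qed (auto simp: T_def)

end

theorem mainTheorem3:
  fixes \<Phi> :: "complex \<Rightarrow> complex"
    and N :: nat and w :: "nat \<Rightarrow> complex"
    and n :: "nat \<Rightarrow> nat" and v :: "nat \<Rightarrow> nat \<Rightarrow> complex"
    and r s m a :: nat
  assumes "\<Phi> holomorphic_on UNIV" and "\<exists>x. \<Phi> x \<noteq> 0" and "\<Phi> 0 = 0"
    and "s \<ge> 1" and "m \<ge> 1" and "a \<ge> 1"
  defines "\<T> \<equiv> T \<Phi> N w n v r s"
  shows "meromorphic_eq
           (\<lambda>u. \<T> m a (u - 1) * \<T> m a (u + 1))
           (\<lambda>u. \<T> (m - 1) a u * \<T> (m + 1) a u + \<T> m (a - 1) u * \<T> m (a + 1) u)"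
proof -
  have mero: "(\<lambda>u. \<T> m a (u + z)) meromorphic_on UNIV" for m a z
    unfolding \<T>_def by (rule T_meromorphic[OF assms(1)])
  have "(\<lambda>u. \<T> m a (u - 1) * \<T> m a (u + 1)) meromorphic_on UNIV"
    using mero[of m a "-1"] mero[of m a 1] by (intro meromorphic_on_mult) simp_all
  \<comment> \<open>\<open>T_hirota\<close> is an identity of complex numbers at every
    \<open>u\<close>, poles included, because the box values enter only as field elements; no
    exceptional set has to be found.\<close>
  then show ?thesis
    unfolding meromorphic_eq_def
    using T_hirota[of m a \<Phi> N w n v r s] assms(5,6) by (simp add: \<T>_def)
qed

end
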